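(* Let $\alpha: I\to E_1^3$ be a unit speed non-lightlike Frenet curve with Frenet frame $\{T,N,B\}$, and let $\beta: I\to E_1^3$ be an $X$-direction curve of $\alpha$, where $X=uT+vN+wB$ is a unit non-lightlike vector field along $\alpha$. Then $\beta$ is a Bertrand-direction curve of $\alpha$ if and only if the following hold: (i) $u(s)=\cosh\theta,\ v(s)=0,\ w(s)=\sinh\theta$, if $\alpha$ is a timelike curve (respectively, spacelike curve of type 2) and $X$ is timelike (respectively, spacelike); (ii) $u(s)=\sinh\theta,\ v(s)=0,\ w(s)=\cosh\theta$, if $\alpha$ is a timelike curve (respectively, spacelike curve of type 2) and $X$ is spacelike (respectively, timelike); (iii) $u(s)=\cos\theta,\ v(s)=0,\ w(s)=\sin\theta$, if $\alpha$ is a spacelike curve of type 1 and $X$ is spacelike. In all cases $\theta$ is the constant angle between the tangent lines of the curves.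
   Context: $E_1^3$ is $\mathbb{R}^3$ with the metric $\langle x,y\rangle=-x_1y_1+x_2y_2+x_3y_3$ and the Lorentz vector product $x\times y=(x_2y_3-x_3y_2,\ x_1y_3-x_3y_1,\ x_2y_1-x_1y_2)$. A vector $x$ is spacelike if $\langle x,x\rangle>0$ or $x=0$, timelike if $\langle x,x\rangle<0$, lightlike if $\langle x,x\rangle=0$ and $x\ne0$. A curve is timelike (spacelike) if all its velocity vectors are; non-lightlike means timelike or spacelike; unit speed means $|\langle\alpha',\alpha'\rangle|=1$. All functions are as differentiable as needed. A unit speed non-lightlike curve $\alpha(s)$ has Frenet frame $\{T,N,B\}$ (orthonormal, non-lightlike vectors, $T=\alpha'$), curvature $\kappa$ and torsion $\tau$ with $T'=\kappa N,\ N'=\varepsilon_B\kappa T+\tau B,\ B'=\varepsilon_T\tau N$, where $\varepsilon_Y=\langle Y,Y\rangle=\pm1$ and $\varepsilon_B=-\varepsilon_T\varepsilon_N$; the frame satisfies $B=\varepsilon_T\varepsilon_N T\times N$, $N=\varepsilon_B\varepsilon_T B\times T$, $T=\varepsilon_N\varepsilon_B N\times B$. It is a Frenet curve if $\kappa\neq0$. A spacelike curve is of type 1 if $N$ is timelike (and $T,B$ spacelike), of type 2 if $B$ is timelike (and $T,N$ spacelike). Let $X(s)=u(s)T(s)+v(s)N(s)+w(s)B(s)$ with $u,v,w$ differentiable and $\varepsilon_Tu^2+\varepsilon_Nv^2+\varepsilon_Bw^2=\pm1$ (constant sign). An $X$-direction curve of $\alpha$ is a curve $\beta$ whose tangent is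 $\overline T=X$ (an integral curve of $X$); $s$ is also arc-length for $\beta$. The Frenet frame, curvature and torsion of $\beta$ are $\{\overline T,\overline N,\overline B\},\overline\kappa,\overline\tau$, with $\overline\kappa\ne0$. $\beta$ is called a Bertrand-direction curve of $\alpha$ if $\beta$ is an $X$-direction curve of $\alpha$ and $\beta$ is a Bertrand curve of $\alpha$ with $\alpha$ a Bertrand partner curve of $\beta$, which means $\overline N=N$ along the curves. $\theta$ is a real constant (independent of $s$).
   Formalization: In (i) and (ii) the triple (u,v,w) is allowed a constant overall sign ±1, since the printed "only if" fails: for timelike α and X = −T, β is a Bertrand-direction curve with u = −1, which is not cosh θ. *)

theory Defs
  imports "HOL-Analysis.Analysis"
begin

section \<open>Minkowski 3-space\<close>

definition lorentz_inner :: "real ^ 3 \<Rightarrow> real ^ 3 \<Rightarrow> real" where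
  "lorentz_inner x y = - (x $ 1 * y $ 1) + x $ 2 * y $ 2 + x $ 3 * y $ 3"

definition lorentz_cross :: "real ^ 3 \<Rightarrow> real ^ 3 \<Rightarrow> real ^ 3" where
  "lorentz_cross x y = vector
     [x $ 2 * y $ 3 - x $ 3 * y $ 2,
      x $ 1 * y $ 3 - x $ 3 * y $ 1,
      x $ 2 * y $ 1 - x $ 1 * y $ 2]"

definition lorentz_norm :: "real ^ 3 \<Rightarrow> real" where
  "lorentz_norm x = sqrt \<bar>lorentz_inner x x\<bar>"

definition spacelike :: "real ^ 3 \<Rightarrow> bool" where
  "spacelike x \<longleftrightarrow> lorentz_inner x x > 0 \<or> x = 0"

definition timelike :: "real ^ 3 \<Rightarrow> bool" where
  "timelike x \<longleftrightarrow> lorentz_inner x x < 0"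

definition spacelike_field :: "real set \<Rightarrow> (real \<Rightarrow> real ^ 3) \<Rightarrow> bool" where
  "spacelike_field I Y \<longleftrightarrow> (\<forall>s\<in>I. spacelike (Y s))"

definition timelike_field :: "real set \<Rightarrow> (real \<Rightarrow> real ^ 3) \<Rightarrow> bool" where
  "timelike_field I Y \<longleftrightarrow> (\<forall>s\<in>I. timelike (Y s))"

text \<open>
  The angle between the lines spanned by two non-zero, non-lightlike vectors. Since the
  vectors may be replaced by their negatives, the products enter through their absolute
  values: \<open>\<theta>\<close> is a signed angle, of which the two lines only determine the modulus (and, in
  the Euclidean case, the residue modulo \<open>\<pi>\<close>). The four clauses are: two timelike lines; a
  timelike and a spacelike line; two spacelike lines spanning a timelike plane (reversed
  Cauchy-Schwarz inequality); two spacelike lines that coincide or span a spacelike plane.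
\<close>
definition lorentz_line_angle :: "real ^ 3 \<Rightarrow> real ^ 3 \<Rightarrow> real \<Rightarrow> bool" where
  "lorentz_line_angle x y \<theta> \<longleftrightarrow>
     \<bar>lorentz_inner x y\<bar> = lorentz_norm x * lorentz_norm y *
       (if timelike x \<and> timelike y then cosh \<theta>
        else if timelike x \<or> timelike y then \<bar>sinh \<theta>\<bar>
        else if (lorentz_inner x y)\<^sup>2 > lorentz_inner x x * lorentz_inner y y then cosh \<theta>
        else \<bar>cos \<theta>\<bar>)"


section \<open>Curves and Frenet frames\<close>

text \<open>
  Derivatives are taken within the parameter interval, which may contain its end points.
\<close>
definition timelike_curve :: "real set \<Rightarrow> (real \<Rightarrow> real ^ 3) \<Rightarrow> bool" where
  "timelike_curve I \<alpha> \<longleftrightarrow> timelike_field I (\<lambda>s. vector_derivative \<alpha> (at s within I))"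

definition spacelike_curve :: "real set \<Rightarrow> (real \<Rightarrow> real ^ 3) \<Rightarrow> bool" where
  "spacelike_curve I \<alpha> \<longleftrightarrow> spacelike_field I (\<lambda>s. vector_derivative \<alpha> (at s within I))"

text \<open>
  \<open>frenet_frame I \<alpha> T N B \<kappa> \<tau>\<close>: the curve \<open>\<alpha>\<close> has unit speed and is non-lightlike, and
  \<open>T, N, B, \<kappa>, \<tau>\<close> is a Frenet apparatus of \<open>\<alpha>\<close> on \<open>I\<close>. The curvature is not required to be
  positive, so the apparatus is determined only up to replacing \<open>N, B, \<kappa>\<close> by their negatives.
\<close>
definition frenet_frame ::
  "real set \<Rightarrow> (real \<Rightarrow> real ^ 3) \<Rightarrow> (real \<Rightarrow> real ^ 3) \<Rightarrow> (real \<Rightarrow> real ^ 3) \<Rightarrow> (real \<Rightarrow> real ^ 3)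
    \<Rightarrow> (real \<Rightarrow> real) \<Rightarrow> (real \<Rightarrow> real) \<Rightarrow> bool" where
  "frenet_frame I \<alpha> T N B \<kappa> \<tau> \<longleftrightarrow>
     (\<forall>s\<in>I.
        let \<epsilon>T = lorentz_inner (T s) (T s);
            \<epsilon>N = lorentz_inner (N s) (N s);
            \<epsilon>B = lorentz_inner (B s) (B s)
        in \<bar>\<epsilon>T\<bar> = 1 \<and> \<bar>\<epsilon>N\<bar> = 1 \<and> \<bar>\<epsilon>B\<bar> = 1 \<and> \<epsilon>B = - \<epsilon>T * \<epsilon>N \<and>
           lorentz_inner (T s) (N s) = 0 \<and>
           lorentz_inner (N s) (B s) = 0 \<and>
           lorentz_inner (B s) (T s) = 0 \<and>
           B s = (\<epsilon>T * \<epsilon>N) *\<^sub>R lorentz_cross (T s) (N s) \<and>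
           N s = (\<epsilon>B * \<epsilon>T) *\<^sub>R lorentz_cross (B s) (T s) \<and>
           T s = (\<epsilon>N * \<epsilon>B) *\<^sub>R lorentz_cross (N s) (B s) \<and>
           (\<alpha> has_vector_derivative T s) (at s within I) \<and>
           (T has_vector_derivative \<kappa> s *\<^sub>R N s) (at s within I) \<and>
           (N has_vector_derivative (\<epsilon>B * \<kappa> s) *\<^sub>R T s + \<tau> s *\<^sub>R B s) (at s within I) \<and>
           (B has_vector_derivative (\<epsilon>T * \<tau> s) *\<^sub>R N s) (at s within I))"

definition frenet_curve ::
  "real set \<Rightarrow> (real \<Rightarrow> real ^ 3) \<Rightarrow> (real \<Rightarrow> real ^ 3) \<Rightarrow> (real \<Rightarrow> real ^ 3) \<Rightarrow> (real \<Rightarrow> real ^ 3)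
    \<Rightarrow> (real \<Rightarrow> real) \<Rightarrow> (real \<Rightarrow> real) \<Rightarrow> bool" where
  "frenet_curve I \<alpha> T N B \<kappa> \<tau> \<longleftrightarrow> frenet_frame I \<alpha> T N B \<kappa> \<tau> \<and> (\<forall>s\<in>I. \<kappa> s \<noteq> 0)"

definition spacelike_curve_type1 ::
  "real set \<Rightarrow> (real \<Rightarrow> real ^ 3) \<Rightarrow> (real \<Rightarrow> real ^ 3) \<Rightarrow> (real \<Rightarrow> real ^ 3) \<Rightarrow> bool" where
  "spacelike_curve_type1 I \<alpha> N B \<longleftrightarrow>
     spacelike_curve I \<alpha> \<and> timelike_field I N \<and> spacelike_field I B"

definition spacelike_curve_type2 ::
  "real set \<Rightarrow> (real \<Rightarrow> real ^ 3) \<Rightarrow> (real \<Rightarrow> real ^ 3) \<Rightarrow> (real \<Rightarrow> real ^ 3) \<Rightarrow> bool" where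
  "spacelike_curve_type2 I \<alpha> N B \<longleftrightarrow>
     spacelike_curve I \<alpha> \<and> spacelike_field I N \<and> timelike_field I B"


section \<open>Direction curves and Bertrand curves\<close>

definition direction_curve :: "real set \<Rightarrow> (real \<Rightarrow> real ^ 3) \<Rightarrow> (real \<Rightarrow> real ^ 3) \<Rightarrow> bool" where
  "direction_curve I X \<beta> \<longleftrightarrow> (\<forall>s\<in>I. (\<beta> has_vector_derivative X s) (at s within I))"

text \<open>
  Here \<open>\<alpha>\<close> comes with the given Frenet apparatus \<open>T, N, B, \<kappa>, \<tau>\<close>. As that of \<open>\<beta>\<close> is only
  determined up to a sign, \<open>\<beta>\<close> is a Bertrand curve of \<open>\<alpha>\<close> (and \<open>\<alpha>\<close> a Bertrand partner curve
  of \<open>\<beta>\<close>) if \<open>\<beta>\<close> has a Frenet apparatus whose principal normal is \<open>N\<close>.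
\<close>
definition bertrand_curve ::
  "real set \<Rightarrow> (real \<Rightarrow> real ^ 3) \<Rightarrow> (real \<Rightarrow> real ^ 3) \<Rightarrow> (real \<Rightarrow> real ^ 3) \<Rightarrow> (real \<Rightarrow> real ^ 3)
    \<Rightarrow> (real \<Rightarrow> real) \<Rightarrow> (real \<Rightarrow> real) \<Rightarrow> (real \<Rightarrow> real ^ 3) \<Rightarrow> bool" where
  "bertrand_curve I \<alpha> T N B \<kappa> \<tau> \<beta> \<longleftrightarrow>
     frenet_curve I \<alpha> T N B \<kappa> \<tau> \<and>
     (\<exists>T' N' B' \<kappa>' \<tau>'. frenet_curve I \<beta> T' N' B' \<kappa>' \<tau>' \<and> (\<forall>s\<in>I. N' s = N s))"

definition bertrand_direction_curve ::
  "real set \<Rightarrow> (real \<Rightarrow> real ^ 3) \<Rightarrow> (real \<Rightarrow> real ^ 3) \<Rightarrow> (real \<Rightarrow> real ^ 3) \<Rightarrow> (real \<Rightarrow> real ^ 3)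
    \<Rightarrow> (real \<Rightarrow> real) \<Rightarrow> (real \<Rightarrow> real) \<Rightarrow> (real \<Rightarrow> real ^ 3) \<Rightarrow> (real \<Rightarrow> real ^ 3) \<Rightarrow> bool" where
  "bertrand_direction_curve I \<alpha> T N B \<kappa> \<tau> X \<beta> \<longleftrightarrow>
     direction_curve I X \<beta> \<and> bertrand_curve I \<alpha> T N B \<kappa> \<tau> \<beta>"

end

(* Orthogonality of X and N means v = 0. Differentiating <X,T> and <X,B> along the curves with
   X' parallel to N shows that u and w are constant, so (u,w) is a point of the conic
   eps_T u^2 + eps_B w^2 = eps, which cosh and sinh or cos and sin parametrise. Conversely, for
   constant u, w and v = 0 the derivative of X is (u kappa + eps_T w tau) N, so rotating T and B
   in their plane gives a Frenet frame of beta with principal normal N; that beta has some Frenet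
   frame with non-zero curvature excludes u kappa + eps_T w tau = 0. *)
theory Submission
  imports Defs
begin

section \<open>Algebra of the Lorentz inner product and vector product\<close>

lemma bilinear_lorentz_inner: "bilinear lorentz_inner"
  unfolding bilinear_def lorentz_inner_def
  by (auto intro!: linearI simp: algebra_simps)

lemmas bounded_bilinear_lorentz_inner =
  bilinear_lorentz_inner[unfolded bilinear_conv_bounded_bilinear]

lemmas lorentz_inner_simps =
  bounded_bilinear.add_left[OF bounded_bilinear_lorentz_inner]
  bounded_bilinear.add_right[OF bounded_bilinear_lorentz_inner]
  bounded_bilinear.diff_left[OF bounded_bilinear_lorentz_inner]
  bounded_bilinear.diff_right[OF bounded_bilinear_lorentz_inner]
  bounded_bilinear.scaleR_left[OF bounded_bilinear_lorentz_inner]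
  bounded_bilinear.scaleR_right[OF bounded_bilinear_lorentz_inner]
  bounded_bilinear.zero_left[OF bounded_bilinear_lorentz_inner]
  bounded_bilinear.zero_right[OF bounded_bilinear_lorentz_inner]

lemma lorentz_inner_commute: "lorentz_inner x y = lorentz_inner y x"
  by (simp add: lorentz_inner_def algebra_simps)

lemma lorentz_cross_simps:
  "lorentz_cross (x + y) z = lorentz_cross x z + lorentz_cross y z"
  "lorentz_cross z (x + y) = lorentz_cross z x + lorentz_cross z y"
  "lorentz_cross (x - y) z = lorentz_cross x z - lorentz_cross y z"
  "lorentz_cross z (x - y) = lorentz_cross z x - lorentz_cross z y"
  "lorentz_cross (c *\<^sub>R x) z = c *\<^sub>R lorentz_cross x z"
  "lorentz_cross z (c *\<^sub>R x) = c *\<^sub>R lorentz_cross z x"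
  "lorentz_cross x x = 0"
  by (simp_all add: lorentz_cross_def vec_eq_iff forall_3 algebra_simps)

lemma lorentz_cross_commute: "lorentz_cross x y = - lorentz_cross y x"
  by (simp add: lorentz_cross_def vec_eq_iff forall_3 algebra_simps)

text \<open>A reversed Cauchy-Schwarz argument: orthogonality makes the product of the first
  coordinates equal to the Euclidean product of the remaining two pairs, which is too small when
  both vectors are timelike. This is what excludes two timelike vectors in one frame.\<close>

lemma timelike_not_orthogonal:
  assumes "timelike x" "timelike y"
  shows "lorentz_inner x y \<noteq> 0"
proof
  assume orth: "lorentz_inner x y = 0"
  define a where "a = (x$2)\<^sup>2 + (x$3)\<^sup>2"
  define b where "b = (y$2)\<^sup>2 + (y$3)\<^sup>2"
  have "a < (x$1)\<^sup>2" "b < (y$1)\<^sup>2" "0 \<le> a" "0 \<le> b"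
    using assms by (auto simp: timelike_def lorentz_inner_def a_def b_def power2_eq_square)
  then have "a * b < (x$1)\<^sup>2 * (y$1)\<^sup>2"
    by (intro mult_strict_mono') auto
  also have "\<dots> = (x$2 * y$2 + x$3 * y$3)\<^sup>2"
  proof -
    have "x$1 * y$1 = x$2 * y$2 + x$3 * y$3"
      using orth by (simp add: lorentz_inner_def)
    then show ?thesis by (simp flip: power_mult_distrib)
  qed
  \<comment> \<open>Lagrange's identity in the plane; the subtracted square gives the
    contradiction.\<close>
  also have "\<dots> = a * b - (x$2 * y$3 - x$3 * y$2)\<^sup>2"
    by (simp add: a_def b_def power2_eq_square algebra_simps)
  finally show False
    using zero_le_power2[of "x$2 * y$3 - x$3 * y$2"] by linarith
qed

section \<open>Calculus on the parameter interval\<close>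

text \<open>By the product rule the inner product has derivative zero on a convex set. It yields the
  constancy of the causal characters of the frame and later that of \<open>u\<close> and
  \<open>w\<close>.\<close>

lemma lorentz_inner_constant:
  assumes "convex I" "s \<in> I" "t \<in> I"
    and "\<And>s. s \<in> I \<Longrightarrow> (f has_vector_derivative f' s) (at s within I)"
    and "\<And>s. s \<in> I \<Longrightarrow> (g has_vector_derivative g' s) (at s within I)"
    and "\<And>s. s \<in> I \<Longrightarrow> lorentz_inner (f s) (g' s) + lorentz_inner (f' s) (g s) = 0"
  shows "lorentz_inner (f s) (g s) = lorentz_inner (f t) (g t)"
proof -
  have "((\<lambda>s. lorentz_inner (f s) (g s)) has_vector_derivative 0) (at s within I)" if "s \<in> I" for s
    using bounded_bilinear.has_vector_derivative
        [OF bounded_bilinear_lorentz_inner assms(4)[OF that] assms(5)[OF that]] assms(6)[OF that]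
    by simp
  then obtain c where "\<And>s. s \<in> I \<Longrightarrow> lorentz_inner (f s) (g s) = c"
    using has_vector_derivative_zero_constant[OF assms(1)] by metis
  then show ?thesis
    using assms(2,3) by simp
qed

text \<open>This makes derivatives within \<open>I\<close> unique, also at end points belonging to
  \<open>I\<close>. Non-empty interior excludes an interval consisting of one point.\<close>

lemma interval_at_within_nontrivial:
  fixes I :: "real set"
  assumes "is_interval I" "interior I \<noteq> {}" "s \<in> I"
  shows "at s within I \<noteq> bot"
proof -
  have "I \<noteq> {x}" for x
    using assms(2) by (metis interior_singleton)
  then have "s islimpt I"
    using assms connected_imp_perfect is_interval_connected by metis
  then show ?thesis
    by (simp add: trivial_limit_within)
qed

section \<open>Frenet frames: causal characters and rotation about the principal normal\<close>

text \<open>The orthogonality relations appear in both orders (facts 5 to 10), so that inner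
  products of frame expansions simplify without commutativity as a rewrite rule.\<close>

lemma frenet_frame_D:
  assumes "frenet_frame I \<alpha> T N B \<kappa> \<tau>" "s \<in> I"
  shows "\<bar>lorentz_inner (T s) (T s)\<bar> = 1" "\<bar>lorentz_inner (N s) (N s)\<bar> = 1"
    "\<bar>lorentz_inner (B s) (B s)\<bar> = 1"
    "lorentz_inner (B s) (B s) = - lorentz_inner (T s) (T s) * lorentz_inner (N s) (N s)"
    "lorentz_inner (T s) (N s) = 0" "lorentz_inner (N s) (B s) = 0" "lorentz_inner (B s) (T s) = 0"
    "lorentz_inner (N s) (T s) = 0" "lorentz_inner (B s) (N s) = 0" "lorentz_inner (T s) (B s) = 0"
    "B s = (lorentz_inner (T s) (T s) * lorentz_inner (N s) (N s)) *\<^sub>R lorentz_cross (T s) (N s)"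
    "N s = (lorentz_inner (B s) (B s) * lorentz_inner (T s) (T s)) *\<^sub>R lorentz_cross (B s) (T s)"
    "T s = (lorentz_inner (N s) (N s) * lorentz_inner (B s) (B s)) *\<^sub>R lorentz_cross (N s) (B s)"
    "(\<alpha> has_vector_derivative T s) (at s within I)"
    "(T has_vector_derivative \<kappa> s *\<^sub>R N s) (at s within I)"
    "(N has_vector_derivative (lorentz_inner (B s) (B s) * \<kappa> s) *\<^sub>R T s + \<tau> s *\<^sub>R B s) (at s within I)"
    "(B has_vector_derivative (lorentz_inner (T s) (T s) * \<tau> s) *\<^sub>R N s) (at s within I)"
  using bspec[OF assms(1)[unfolded frenet_frame_def Let_def] assms(2)]
    lorentz_inner_commute[of "N s" "T s"] lorentz_inner_commute[of "B s" "N s"]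
    lorentz_inner_commute[of "T s" "B s"]
  by - (elim conjE, (assumption | (erule trans, assumption)))+

text \<open>The definition fixes the squares only pointwise up to sign. They cannot jump, because by
  the Frenet formulas each frame vector is orthogonal to its own derivative.\<close>

lemma frenet_frame_causal_constant:
  assumes "frenet_frame I \<alpha> T N B \<kappa> \<tau>" "convex I" "s \<in> I" "t \<in> I"
  shows "lorentz_inner (T s) (T s) = lorentz_inner (T t) (T t)"
    "lorentz_inner (N s) (N s) = lorentz_inner (N t) (N t)"
    "lorentz_inner (B s) (B s) = lorentz_inner (B t) (B t)"
proof -
  note F = frenet_frame_D[OF assms(1)]
  show "lorentz_inner (T s) (T s) = lorentz_inner (T t) (T t)"
    by (rule lorentz_inner_constant[OF assms(2-4) F(15,15)]) (simp_all add: lorentz_inner_simps F(5-10))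
  show "lorentz_inner (N s) (N s) = lorentz_inner (N t) (N t)"
    by (rule lorentz_inner_constant[OF assms(2-4) F(16,16)]) (simp_all add: lorentz_inner_simps F(5-10))
  show "lorentz_inner (B s) (B s) = lorentz_inner (B t) (B t)"
    by (rule lorentz_inner_constant[OF assms(2-4) F(17,17)]) (simp_all add: lorentz_inner_simps F(5-10))
qed

text \<open>The relation between the three signs leaves four patterns; the one with \<open>T\<close>
  and \<open>N\<close> both timelike is impossible for orthogonal vectors.\<close>

lemma frenet_frame_signature:
  assumes "frenet_frame I \<alpha> T N B \<kappa> \<tau>" "s \<in> I"
  obtains "lorentz_inner (T s) (T s) = -1" "lorentz_inner (N s) (N s) = 1" "lorentz_inner (B s) (B s) = 1"
  | "lorentz_inner (T s) (T s) = 1" "lorentz_inner (N s) (N s) = -1" "lorentz_inner (B s) (B s) = 1"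
  | "lorentz_inner (T s) (T s) = 1" "lorentz_inner (N s) (N s) = 1" "lorentz_inner (B s) (B s) = -1"
proof -
  have "\<not> (timelike (T s) \<and> timelike (N s))"
    using timelike_not_orthogonal frenet_frame_D(5)[OF assms] by blast
  with frenet_frame_D(1,2,4)[OF assms] that show thesis
    by (auto simp: timelike_def abs_if split: if_splits)
qed

text \<open>With constant \<open>a\<close>, \<open>b\<close> the derivative of \<open>X\<close>
  stays parallel to \<open>N\<close>, since those of \<open>T\<close> and \<open>B\<close> are. The
  coefficients of the new binormal are forced by the vector product of \<open>X\<close> and
  \<open>N\<close>. The new curvature may still vanish here, so the result is only a frame.\<close>

lemma frenet_frame_rotate:
  assumes fr: "frenet_frame I \<alpha> T N B \<kappa> \<tau>"
    and \<epsilon>T: "\<And>s. s \<in> I \<Longrightarrow> lorentz_inner (T s) (T s) = p"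
    and \<epsilon>B: "\<And>s. s \<in> I \<Longrightarrow> lorentz_inner (B s) (B s) = r"
    and X: "\<And>s. s \<in> I \<Longrightarrow> X s = a *\<^sub>R T s + b *\<^sub>R B s"
    and unit: "e = p * a\<^sup>2 + r * b\<^sup>2" "\<bar>e\<bar> = 1"
    and \<beta>: "direction_curve I X \<beta>"
  shows "frenet_frame I \<beta> X N (\<lambda>s. (e * p * a) *\<^sub>R B s - (e * r * b) *\<^sub>R T s)
    (\<lambda>s. a * \<kappa> s + b * p * \<tau> s) (\<lambda>s. a * \<tau> s - b * r * \<kappa> s)"
proof -
  let ?X = "\<lambda>s. a *\<^sub>R T s + b *\<^sub>R B s"
  let ?B = "\<lambda>s. (e * p * a) *\<^sub>R B s - (e * r * b) *\<^sub>R T s"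
  show ?thesis
    unfolding frenet_frame_def Let_def
  proof
    fix s assume s: "s \<in> I"
    note F = frenet_frame_D[OF fr s, unfolded \<epsilon>T[OF s] \<epsilon>B[OF s]]
    define q where "q = lorentz_inner (N s) (N s)"
    note F = F[folded q_def]
    have sq: "p * p = 1" "q * q = 1" "r * r = 1" "e * e = 1"
      using F(1-3) unit(2) by (auto simp: abs_if split: if_splits)
    have r: "r = - p * q" by (rule F(4))
    have rp: "r * p = - q" and rq: "r * q = - p" and pq: "p * q = - r"
      using sq r by algebra+
    \<comment> \<open>Multiplying the unit condition by \<open>- q\<close> interchanges
      \<open>p\<close> and \<open>r\<close>; this computes the square of the new binormal.\<close>
    have conic': "r * a\<^sup>2 + p * b\<^sup>2 = - e * q"
      using rq pq unfolding unit(1) by algebra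
    have XX: "lorentz_inner (X s) (X s) = e"
      unfolding X[OF s] unit(1)
      by (simp add: lorentz_inner_simps F(5-10) \<epsilon>T \<epsilon>B s power2_eq_square algebra_simps)
    have BB: "lorentz_inner (?B s) (?B s) = - e * q"
    proof -
      have "lorentz_inner (?B s) (?B s) = (e * e) * ((p * p) * r * a\<^sup>2 + (r * r) * p * b\<^sup>2)"
        by (simp add: lorentz_inner_simps F(5-10) \<epsilon>T \<epsilon>B s power2_eq_square algebra_simps)
      also have "\<dots> = r * a\<^sup>2 + p * b\<^sup>2" by (simp add: sq)
      finally show ?thesis by (simp only: conic')
    qed
    \<comment> \<open>The vector product relations of the frame are solved for the products; each
      scalar is a sign and hence its own inverse.\<close>
    have c: "lorentz_cross (T s) (N s) = (p * q) *\<^sub>R B s"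
      "lorentz_cross (B s) (T s) = (r * p) *\<^sub>R N s"
      "lorentz_cross (N s) (B s) = (q * r) *\<^sub>R T s"
    proof -
      have scale: "x = c *\<^sub>R y" if "y = c *\<^sub>R x" "c * c = 1" for c :: real and x y :: "real ^ 3"
        using that by simp
      have "p * q * (p * q) = 1" "r * p * (r * p) = 1" "q * r * (q * r) = 1"
        using sq by algebra+
      then show "lorentz_cross (T s) (N s) = (p * q) *\<^sub>R B s"
        "lorentz_cross (B s) (T s) = (r * p) *\<^sub>R N s"
        "lorentz_cross (N s) (B s) = (q * r) *\<^sub>R T s"
        using scale F(11-13) by blast+
    qed
    have c': "lorentz_cross (N s) (T s) = - ((p * q) *\<^sub>R B s)"
      "lorentz_cross (T s) (B s) = - ((r * p) *\<^sub>R N s)"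
      "lorentz_cross (B s) (N s) = - ((q * r) *\<^sub>R T s)"
      using c lorentz_cross_commute by metis+
    have dX: "(?X has_vector_derivative (a * \<kappa> s + b * p * \<tau> s) *\<^sub>R N s) (at s within I)"
      by (rule has_vector_derivative_eq_rhs, (rule derivative_intros F(15,17))+)
        (simp add: algebra_simps)
    have dB: "(?B has_vector_derivative (e * (a * \<tau> s - b * r * \<kappa> s)) *\<^sub>R N s) (at s within I)"
    proof -
      have "(?B has_vector_derivative ((e * p * a) *\<^sub>R ((p * \<tau> s) *\<^sub>R N s) -
          (e * r * b) *\<^sub>R (\<kappa> s *\<^sub>R N s))) (at s within I)"
        by (auto intro!: derivative_eq_intros F(15,17))
      moreover have "e * p * a * (p * \<tau> s) - e * r * b * \<kappa> s = e * (a * \<tau> s - b * r * \<kappa> s)"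
        using sq by algebra
      ultimately show ?thesis by (simp flip: scaleR_diff_left)
    qed
    show "\<bar>lorentz_inner (X s) (X s)\<bar> = 1 \<and> \<bar>lorentz_inner (N s) (N s)\<bar> = 1 \<and>
      \<bar>lorentz_inner (?B s) (?B s)\<bar> = 1 \<and>
      lorentz_inner (?B s) (?B s) = - lorentz_inner (X s) (X s) * lorentz_inner (N s) (N s) \<and>
      lorentz_inner (X s) (N s) = 0 \<and> lorentz_inner (N s) (?B s) = 0 \<and>
      lorentz_inner (?B s) (X s) = 0 \<and>
      ?B s = (lorentz_inner (X s) (X s) * lorentz_inner (N s) (N s)) *\<^sub>R lorentz_cross (X s) (N s) \<and>
      N s = (lorentz_inner (?B s) (?B s) * lorentz_inner (X s) (X s)) *\<^sub>R lorentz_cross (?B s) (X s) \<and>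
      X s = (lorentz_inner (N s) (N s) * lorentz_inner (?B s) (?B s)) *\<^sub>R lorentz_cross (N s) (?B s) \<and>
      (\<beta> has_vector_derivative X s) (at s within I) \<and>
      (X has_vector_derivative (a * \<kappa> s + b * p * \<tau> s) *\<^sub>R N s) (at s within I) \<and>
      (N has_vector_derivative (lorentz_inner (?B s) (?B s) * (a * \<kappa> s + b * p * \<tau> s)) *\<^sub>R X s +
        (a * \<tau> s - b * r * \<kappa> s) *\<^sub>R ?B s) (at s within I) \<and>
      (?B has_vector_derivative (lorentz_inner (X s) (X s) * (a * \<tau> s - b * r * \<kappa> s)) *\<^sub>R N s)
        (at s within I)"
      unfolding XX BB q_def[symmetric]
    proof (intro conjI)
      show "\<bar>e\<bar> = 1" "\<bar>q\<bar> = 1" "- e * q = - e * q" by (fact unit(2) F(2) refl)+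
      show "\<bar>- e * q\<bar> = 1" by (simp add: abs_mult unit(2) F(2))
      show "lorentz_inner (X s) (N s) = 0" "lorentz_inner (N s) (?B s) = 0"
        "lorentz_inner (?B s) (X s) = 0"
        by (simp_all add: X[OF s] lorentz_inner_simps F(5-10) \<epsilon>T \<epsilon>B s)
      show "?B s = (e * q) *\<^sub>R lorentz_cross (X s) (N s)"
      proof -
        have "e * q * (a * (p * q)) = e * p * a" "e * q * (b * (q * r)) = e * r * b"
          using sq by algebra+
        moreover have "lorentz_cross (X s) (N s) = (a * (p * q)) *\<^sub>R B s - (b * (q * r)) *\<^sub>R T s"
          by (simp add: X[OF s] lorentz_cross_simps c c')
        ultimately show ?thesis
          by (simp only: scaleR_diff_right scaleR_scaleR)
      qed
      show "N s = (- e * q * e) *\<^sub>R lorentz_cross (?B s) (X s)"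
      proof -
        \<comment> \<open>Up to squares of signs, the bracket is \<open>e\<close> times the left
          side of \<open>conic'\<close>, so the whole scalar reduces to a product of squares of
          signs.\<close>
        have "- e * q * e * (a * (e * p * a * (r * p)) + b * (e * r * b * (r * p)))
          = - (e * e) * e * q * ((p * p) * r * a\<^sup>2 + (r * r) * p * b\<^sup>2)"
          by algebra
        also have "\<dots> = 1"
        proof -
          have "e * q * (e * q) = 1"
            using sq by algebra
          then show ?thesis
            by (simp add: sq conic')
        qed
        finally have "- e * q * e * (a * (e * p * a * (r * p)) + b * (e * r * b * (r * p))) = 1" .
        moreover have "lorentz_cross (?B s) (X s)
          = (a * (e * p * a * (r * p)) + b * (e * r * b * (r * p))) *\<^sub>R N s"
          by (simp add: X[OF s] lorentz_cross_simps c c' algebra_simps)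
        ultimately show ?thesis
          by (simp only: scaleR_scaleR scaleR_one)
      qed
      show "X s = (q * (- e * q)) *\<^sub>R lorentz_cross (N s) (?B s)"
      proof -
        have "q * (- e * q) * (e * p * a * (q * r)) = a" "q * (- e * q) * (e * r * b * (p * q)) = b"
          using sq rp rq by algebra+
        moreover have "lorentz_cross (N s) (?B s)
          = (e * p * a * (q * r)) *\<^sub>R T s + (e * r * b * (p * q)) *\<^sub>R B s"
          by (simp add: lorentz_cross_simps c c')
        ultimately show ?thesis
          by (simp only: X[OF s] scaleR_add_right scaleR_scaleR)
      qed
      show "(\<beta> has_vector_derivative X s) (at s within I)"
        using \<beta> s by (simp add: direction_curve_def)
      show "(X has_vector_derivative (a * \<kappa> s + b * p * \<tau> s) *\<^sub>R N s) (at s within I)"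
        using has_vector_derivative_transform[OF s X dX] .
      show "(N has_vector_derivative (- e * q * (a * \<kappa> s + b * p * \<tau> s)) *\<^sub>R X s +
        (a * \<tau> s - b * r * \<kappa> s) *\<^sub>R ?B s) (at s within I)"
      proof -
        \<comment> \<open>Expanded in \<open>T\<close> and \<open>B\<close>, the claimed derivative
          loses all trace of the rotation: the coefficients of the original Frenet formula for
          \<open>N\<close> remain.\<close>
        have "- e * q * (a * \<kappa> s + b * p * \<tau> s) * a - (a * \<tau> s - b * r * \<kappa> s) * (e * r * b) = r * \<kappa> s"
          "- e * q * (a * \<kappa> s + b * p * \<tau> s) * b + (a * \<tau> s - b * r * \<kappa> s) * (e * p * a) = \<tau> s"
          using sq rp rq r unit(1) by algebra+
        moreover have "k *\<^sub>R X s + t *\<^sub>R ?B s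
          = (k * a - t * (e * r * b)) *\<^sub>R T s + (k * b + t * (e * p * a)) *\<^sub>R B s" for k t
          by (simp add: X[OF s] algebra_simps)
        ultimately have "(- e * q * (a * \<kappa> s + b * p * \<tau> s)) *\<^sub>R X s + (a * \<tau> s - b * r * \<kappa> s) *\<^sub>R ?B s
          = (r * \<kappa> s) *\<^sub>R T s + \<tau> s *\<^sub>R B s"
          by metis
        with F(16) show ?thesis by simp
      qed
      show "(?B has_vector_derivative (e * (a * \<tau> s - b * r * \<kappa> s)) *\<^sub>R N s) (at s within I)"
        by (rule dB)
    qed
  qed
qed

section \<open>Parametrising the hyperbola, and causal characters of vector fields\<close>

text \<open>Since cosh is positive, it reaches only one branch of the hyperbola;
  \<open>\<sigma>\<close> selects the branch. This is the origin of the sign in the hyperbolic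
  clauses of the theorem.\<close>

lemma hyperbolic_parametrisation:
  fixes x y :: real
  assumes "x\<^sup>2 - y\<^sup>2 = 1"
  obtains \<sigma> \<theta> where "\<sigma> \<in> {1, -1}" "x = \<sigma> * cosh \<theta>" "y = \<sigma> * sinh \<theta>"
proof
  define \<sigma> :: real where "\<sigma> = (if x < 0 then -1 else 1)"
  define \<theta> where "\<theta> = arsinh (\<sigma> * y)"
  have "\<sigma> * \<sigma> = 1" by (simp add: \<sigma>_def)
  then have y: "\<sigma> * sinh \<theta> = y"
    by (simp add: \<theta>_def sinh_arsinh_real mult.assoc[symmetric])
  have "cosh \<theta> ^ 2 = x ^ 2"
    using cosh_square_eq[of \<theta>] assms y by (auto simp: \<sigma>_def split: if_splits)
  then have "cosh \<theta> = \<bar>x\<bar>"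
    by (metis abs_of_nonneg cosh_real_nonneg power2_eq_iff abs_eq_iff)
  then show "x = \<sigma> * cosh \<theta>" by (simp add: \<sigma>_def)
  show "\<sigma> \<in> {1, -1}" "y = \<sigma> * sinh \<theta>" using y by (auto simp: \<sigma>_def)
qed

text \<open>As the zero vector counts as spacelike, \<open>c \<noteq> 0\<close> is what turns
  spacelike into a strict sign condition.\<close>

lemma field_causal_character:
  assumes "I \<noteq> {}" "c \<noteq> 0" "\<And>s. s \<in> I \<Longrightarrow> lorentz_inner (Y s) (Y s) = c"
  shows "timelike_field I Y \<longleftrightarrow> c < 0" "spacelike_field I Y \<longleftrightarrow> c > 0"
proof -
  have "Y s \<noteq> 0" if "s \<in> I" for s
    using assms(2) assms(3)[OF that] by (auto simp: lorentz_inner_simps)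
  then show "timelike_field I Y \<longleftrightarrow> c < 0" "spacelike_field I Y \<longleftrightarrow> c > 0"
    using assms(1,3) by (auto simp: timelike_field_def spacelike_field_def timelike_def spacelike_def)
qed

section \<open>Characterisation of Bertrand-direction curves\<close>

theorem theorem5p1:
  fixes I :: "real set"
    and \<alpha> \<beta> T N B X :: "real \<Rightarrow> real ^ 3"
    and \<kappa> \<tau> u v w :: "real \<Rightarrow> real"
  assumes "is_interval I" and "interior I \<noteq> {}"
    and "frenet_curve I \<alpha> T N B \<kappa> \<tau>"
    and "u differentiable_on I" and "v differentiable_on I" and "w differentiable_on I"
    and "\<forall>s\<in>I. X s = u s *\<^sub>R T s + v s *\<^sub>R N s + w s *\<^sub>R B s"
    and "\<exists>\<epsilon>\<in>{1, -1}. \<forall>s\<in>I.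
           lorentz_inner (T s) (T s) * (u s)\<^sup>2 + lorentz_inner (N s) (N s) * (v s)\<^sup>2
             + lorentz_inner (B s) (B s) * (w s)\<^sup>2 = \<epsilon>"
    and "direction_curve I X \<beta>"
    and "\<exists>T' N' B' \<kappa>' \<tau>'. frenet_curve I \<beta> T' N' B' \<kappa>' \<tau>'"
  shows "let C = (\<lambda>\<theta>.
      (((timelike_curve I \<alpha> \<and> timelike_field I X) \<or>
        (spacelike_curve_type2 I \<alpha> N B \<and> spacelike_field I X)) \<and>
       (\<exists>\<sigma>\<in>{1, -1}. \<forall>s\<in>I. u s = \<sigma> * cosh \<theta> \<and> v s = 0 \<and> w s = \<sigma> * sinh \<theta>)) \<or>
      (((timelike_curve I \<alpha> \<and> spacelike_field I X) \<or>
        (spacelike_curve_type2 I \<alpha> N B \<and> timelike_field I X)) \<and>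
       (\<exists>\<sigma>\<in>{1, -1}. \<forall>s\<in>I. u s = \<sigma> * sinh \<theta> \<and> v s = 0 \<and> w s = \<sigma> * cosh \<theta>)) \<or>
      (spacelike_curve_type1 I \<alpha> N B \<and> spacelike_field I X \<and>
       (\<forall>s\<in>I. u s = cos \<theta> \<and> v s = 0 \<and> w s = sin \<theta>)))
    in (bertrand_direction_curve I \<alpha> T N B \<kappa> \<tau> X \<beta> \<longleftrightarrow> (\<exists>\<theta>. C \<theta>)) \<and>
       (\<forall>\<theta>. C \<theta> \<longrightarrow> (\<forall>s\<in>I. lorentz_line_angle (T s) (X s) \<theta>))"
proof -
  \<comment> \<open>The coefficient conditions stay opaque so that the causal conditions in
    \<open>C\<close> can be reduced to the signs \<open>p\<close>, \<open>q\<close>,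
    \<open>r\<close>, \<open>e\<close> first.\<close>
  define A where "A \<theta> \<longleftrightarrow> (\<exists>\<sigma>\<in>{1, -1}. \<forall>s\<in>I. u s = \<sigma> * cosh \<theta> \<and> v s = 0 \<and> w s = \<sigma> * sinh \<theta>)" for \<theta>
  define A' where "A' \<theta> \<longleftrightarrow> (\<exists>\<sigma>\<in>{1, -1}. \<forall>s\<in>I. u s = \<sigma> * sinh \<theta> \<and> v s = 0 \<and> w s = \<sigma> * cosh \<theta>)" for \<theta>
  define A'' where "A'' \<theta> \<longleftrightarrow> (\<forall>s\<in>I. u s = cos \<theta> \<and> v s = 0 \<and> w s = sin \<theta>)" for \<theta>
  define C where "C \<theta> \<longleftrightarrow>
      (((timelike_curve I \<alpha> \<and> timelike_field I X) \<or>
        (spacelike_curve_type2 I \<alpha> N B \<and> spacelike_field I X)) \<and> A \<theta>) \<or>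
      (((timelike_curve I \<alpha> \<and> spacelike_field I X) \<or>
        (spacelike_curve_type2 I \<alpha> N B \<and> timelike_field I X)) \<and> A' \<theta>) \<or>
      (spacelike_curve_type1 I \<alpha> N B \<and> spacelike_field I X \<and> A'' \<theta>)" for \<theta>
  have fr: "frenet_frame I \<alpha> T N B \<kappa> \<tau>"
    using assms(3) by (simp add: frenet_curve_def)
  note F = frenet_frame_D[OF fr]
  have X: "X s = u s *\<^sub>R T s + v s *\<^sub>R N s + w s *\<^sub>R B s" if "s \<in> I" for s
    using assms(7) that by blast
  have conv: "convex I"
    using assms(1) by (rule is_interval_convex)
  have nontriv: "at s within I \<noteq> bot" if "s \<in> I" for s
    using interval_at_within_nontrivial assms(1,2) that .
  obtain s0 where s0: "s0 \<in> I"
    using assms(2) interior_subset by blast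
  then have ne: "I \<noteq> {}" by blast
  \<comment> \<open>The signs are read off at a base point and hold on all of \<open>I\<close> by
    constancy.\<close>
  define p q r where "p = lorentz_inner (T s0) (T s0)"
    and "q = lorentz_inner (N s0) (N s0)" and "r = lorentz_inner (B s0) (B s0)"
  have E: "lorentz_inner (T s) (T s) = p" "lorentz_inner (N s) (N s) = q"
    "lorentz_inner (B s) (B s) = r" if "s \<in> I" for s
    unfolding p_def q_def r_def
    using frenet_frame_causal_constant[OF fr conv that s0] by auto
  have signs: "p = -1 \<and> q = 1 \<and> r = 1 \<or> p = 1 \<and> q = -1 \<and> r = 1 \<or> p = 1 \<and> q = 1 \<and> r = -1"
    using frenet_frame_signature[OF fr s0] unfolding p_def q_def r_def by metis
  obtain e where e: "e = 1 \<or> e = -1"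
    and conic: "\<And>s. s \<in> I \<Longrightarrow> p * (u s)\<^sup>2 + q * (v s)\<^sup>2 + r * (w s)\<^sup>2 = e"
    using assms(8) E by fastforce
  have nz: "p \<noteq> 0" "q \<noteq> 0" "r \<noteq> 0" "e \<noteq> 0"
    using signs e by auto
  have XX: "lorentz_inner (X s) (X s) = e" if "s \<in> I" for s
    using conic[OF that]
    by (simp add: X lorentz_inner_simps F(5-10) E that power2_eq_square algebra_simps)
  have XT: "lorentz_inner (X s) (T s) = p * u s" and XN: "lorentz_inner (X s) (N s) = q * v s"
    and XB: "lorentz_inner (X s) (B s) = r * w s" if "s \<in> I" for s
    by (simp_all add: X lorentz_inner_simps F(5-10) E that)
  have vd: "vector_derivative \<alpha> (at s within I) = T s" if "s \<in> I" for s
    using vector_derivative_within[OF nontriv[OF that] F(14)[OF that]] .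
  then have "timelike_curve I \<alpha> \<longleftrightarrow> p < 0" "spacelike_curve I \<alpha> \<longleftrightarrow> p > 0"
    unfolding timelike_curve_def spacelike_curve_def
    using field_causal_character[OF ne nz(1), of "\<lambda>s. vector_derivative \<alpha> (at s within I)"] vd E
    by simp_all
  moreover have "timelike_field I X \<longleftrightarrow> e < 0" "spacelike_field I X \<longleftrightarrow> e > 0"
    "timelike_field I N \<longleftrightarrow> q < 0" "spacelike_field I N \<longleftrightarrow> q > 0"
    "timelike_field I B \<longleftrightarrow> r < 0" "spacelike_field I B \<longleftrightarrow> r > 0"
    using field_causal_character[OF ne nz(4) XX] field_causal_character[OF ne nz(2) E(2)]
      field_causal_character[OF ne nz(3) E(3)]
    by simp_all
  \<comment> \<open>By \<open>signs\<close>, exactly one of \<open>p\<close>, \<open>q\<close>,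
    \<open>r\<close> is -1, and it identifies a timelike curve, type 1 or type 2
    respectively.\<close>
  ultimately have C_iff: "C \<theta> \<longleftrightarrow>
      (p = -1 \<and> e = -1 \<or> r = -1 \<and> e = 1) \<and> A \<theta> \<or>
      (p = -1 \<and> e = 1 \<or> r = -1 \<and> e = -1) \<and> A' \<theta> \<or> q = -1 \<and> e = 1 \<and> A'' \<theta>" for \<theta>
    unfolding C_def spacelike_curve_type1_def spacelike_curve_type2_def
    using signs e by (elim disjE conjE) simp_all

  have angle: "lorentz_line_angle (T s) (X s) \<theta>" if "C \<theta>" and s: "s \<in> I" for \<theta> s
  proof -
    have "sqrt \<bar>p\<bar> * sqrt \<bar>e\<bar> = 1"
      using signs e by auto
    then have angle_iff: "lorentz_line_angle (T s) (X s) \<theta> \<longleftrightarrow> \<bar>p * u s\<bar> =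
        (if p < 0 \<and> e < 0 then cosh \<theta> else if p < 0 \<or> e < 0 then \<bar>sinh \<theta>\<bar>
         else if (p * u s)\<^sup>2 > p * e then cosh \<theta> else \<bar>cos \<theta>\<bar>)"
      unfolding lorentz_line_angle_def lorentz_norm_def timelike_def
        lorentz_inner_commute[of "T s" "X s"] XT[OF s] XX[OF s] E(1)[OF s] by simp
    \<comment> \<open>For type 2 with \<open>X\<close> spacelike, the cosh clause of the angle needs
      a strict inequality. It fails only at angle zero, where the lines coincide and the cos clause
      gives the same value 1.\<close>
    have "\<theta> = 0" if "\<not> 1 < (cosh \<theta>)\<^sup>2"
      using that by (simp add: cosh_square_eq)
    then have coincide: "\<bar>cos \<theta>\<bar> = cosh \<theta>" if "\<not> 1 < (cosh \<theta>)\<^sup>2"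
      using that by fastforce
    have "\<bar>u s\<bar> = cosh \<theta>" if "A \<theta>"
      using that s unfolding A_def by (auto simp: abs_mult)
    moreover have "\<bar>u s\<bar> = \<bar>sinh \<theta>\<bar>" if "A' \<theta>"
      using that s unfolding A'_def by (auto simp: abs_mult)
    moreover have "u s = cos \<theta>" "\<not> 1 < (u s)\<^sup>2" if "A'' \<theta>"
      using that s unfolding A''_def by (auto simp: not_less abs_square_le_1)
    moreover have "p = 1" if "r = -1 \<or> q = -1"
      using that signs by auto
    ultimately show ?thesis
      using \<open>C \<theta>\<close> coincide power2_abs[of "u s"]
      unfolding C_iff angle_iff by (elim disjE conjE) simp_all
  qed

  obtain T' N' B' \<kappa>' \<tau>' where fr': "frenet_frame I \<beta> T' N' B' \<kappa>' \<tau>'"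
    and \<kappa>': "\<And>s. s \<in> I \<Longrightarrow> \<kappa>' s \<noteq> 0"
    using assms(10) by (auto simp: frenet_curve_def)
  \<comment> \<open>Stated for an arbitrary frame of \<open>\<beta>\<close>, because two are
    compared: the one with normal \<open>N\<close> and the one assumed to have non-zero
    curvature.\<close>
  have tangent: "X s = Y s" if "frenet_frame I \<beta> Y M D k t" "s \<in> I" for Y M D k t s
    using vector_derivative_unique_within[OF nontriv[OF that(2)]] assms(9)
      frenet_frame_D(14)[OF that] that(2)
    unfolding direction_curve_def by blast
  have X_deriv: "(X has_vector_derivative k s *\<^sub>R M s) (at s within I)"
    if "frenet_frame I \<beta> Y M D k t" "s \<in> I" for Y M D k t s
    using frenet_frame_D(15)[OF that] has_vector_derivative_transform[OF that(2)]
      tangent[OF that(1)] by blast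

  have "\<exists>\<theta>. C \<theta>" if bertrand: "bertrand_direction_curve I \<alpha> T N B \<kappa> \<tau> X \<beta>"
  proof -
    obtain Y M D k t where fb: "frenet_frame I \<beta> Y M D k t" and M: "\<And>s. s \<in> I \<Longrightarrow> M s = N s"
      and k: "\<And>s. s \<in> I \<Longrightarrow> k s \<noteq> 0"
      using bertrand unfolding bertrand_direction_curve_def bertrand_curve_def frenet_curve_def
      by blast
    have dX: "(X has_vector_derivative k s *\<^sub>R N s) (at s within I)" if "s \<in> I" for s
      using X_deriv[OF fb that] M[OF that] by simp
    have v: "v s = 0" if s: "s \<in> I" for s
    proof -
      have "lorentz_inner (X s) (N s) = 0"
        using tangent[OF fb s] frenet_frame_D(5)[OF fb s] M[OF s] by simp
      then show ?thesis
        using XN[OF s] signs by auto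
    qed
    \<comment> \<open>Both product rule terms vanish: \<open>X\<close> is orthogonal to
      \<open>N\<close>, hence to the derivative of \<open>T\<close>, and the derivative of
      \<open>X\<close> is parallel to \<open>N\<close>, hence orthogonal to \<open>T\<close>. The
      same works for \<open>B\<close>.\<close>
    have "lorentz_inner (X s) (T s) = lorentz_inner (X s0) (T s0)" if "s \<in> I" for s
      by (rule lorentz_inner_constant[OF conv that s0 dX F(15)])
        (simp_all add: lorentz_inner_simps F(5-10) XN v)
    then have u: "u s = u s0" if "s \<in> I" for s
      using XT[OF that] XT[OF s0] nz(1) that by simp
    have "lorentz_inner (X s) (B s) = lorentz_inner (X s0) (B s0)" if "s \<in> I" for s
      by (rule lorentz_inner_constant[OF conv that s0 dX F(17)])
        (simp_all add: lorentz_inner_simps F(5-10) XN v)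
    then have w: "w s = w s0" if "s \<in> I" for s
      using XB[OF that] XB[OF s0] nz(3) that by simp
    have conic0: "p * (u s0)\<^sup>2 + r * (w s0)\<^sup>2 = e"
      using conic[OF s0] v[OF s0] by simp
    consider "(p = -1 \<and> e = -1 \<or> r = -1 \<and> e = 1)" "(u s0)\<^sup>2 - (w s0)\<^sup>2 = 1"
      | "(p = -1 \<and> e = 1 \<or> r = -1 \<and> e = -1)" "(w s0)\<^sup>2 - (u s0)\<^sup>2 = 1"
      | "q = -1" "e = 1" "(u s0)\<^sup>2 + (w s0)\<^sup>2 = 1"
    proof -
      \<comment> \<open>A timelike \<open>X\<close> along a type 1 curve cannot occur:
        \<open>T\<close> and \<open>B\<close> span a positive definite plane.\<close>
      have "p * (u s0)\<^sup>2 + r * (w s0)\<^sup>2 \<noteq> -1" if "p = 1" "r = 1"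
        unfolding that using sum_power2_ge_zero[of "u s0" "w s0"] by linarith
      then show thesis
        using signs e conic0 that by (elim disjE conjE) simp_all
    qed
    then show ?thesis
    proof cases
      case 1
      from 1(2) obtain \<sigma> \<theta> where "\<sigma> \<in> {1, -1}" "u s0 = \<sigma> * cosh \<theta>" "w s0 = \<sigma> * sinh \<theta>"
        by (rule hyperbolic_parametrisation)
      then have "A \<theta>" unfolding A_def using u v w by metis
      then show ?thesis using 1 C_iff by blast
    next
      case 2
      \<comment> \<open>The same parametrisation with \<open>u\<close> and \<open>w\<close>
        exchanged.\<close>
      from 2(2) obtain \<sigma> \<theta> where "\<sigma> \<in> {1, -1}" "w s0 = \<sigma> * cosh \<theta>" "u s0 = \<sigma> * sinh \<theta>"
        by (rule hyperbolic_parametrisation)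
      then have "A' \<theta>" unfolding A'_def using u v w by metis
      then show ?thesis using 2 C_iff by blast
    next
      case 3
      then obtain \<theta> where "u s0 = cos \<theta>" "w s0 = sin \<theta>"
        using sincos_total_2pi by metis
      then have "A'' \<theta>" unfolding A''_def using u v w by metis
      then show ?thesis using 3 C_iff by blast
    qed
  qed

  moreover have "bertrand_direction_curve I \<alpha> T N B \<kappa> \<tau> X \<beta>" if "C \<theta>" for \<theta>
  proof -
    \<comment> \<open>In all three clauses of \<open>C\<close> the coefficients are constants, with
      the sign \<open>\<sigma>\<close> absorbed into \<open>a\<close> and \<open>b\<close>.\<close>
    obtain a b where ab: "\<And>s. s \<in> I \<Longrightarrow> u s = a \<and> v s = 0 \<and> w s = b"
      using \<open>C \<theta>\<close> unfolding C_def A_def A'_def A''_def by metis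
    have e_ab: "e = p * a\<^sup>2 + r * b\<^sup>2" "\<bar>e\<bar> = 1"
      using conic[OF s0] ab[OF s0] e by auto
    define k where "k s = a * \<kappa> s + b * p * \<tau> s" for s
    obtain D t where fb: "frenet_frame I \<beta> X N D k t"
      unfolding k_def
      using frenet_frame_rotate[OF fr E(1,3) _ e_ab assms(9)] X ab by simp
    have "k s \<noteq> 0" if "s \<in> I" for s
    proof
      assume "k s = 0"
      \<comment> \<open>Both frames of \<open>\<beta>\<close> express the same derivative of
        \<open>X\<close>. As \<open>N'\<close> has square 1 or -1 it is non-zero, so the vanishing
        of \<open>k\<close> would force that of \<open>\<kappa>'\<close>.\<close>
      then have "\<kappa>' s *\<^sub>R N' s = 0"
        using vector_derivative_unique_within[OF nontriv X_deriv[OF fb] X_deriv[OF fr']] that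
        by (metis scaleR_zero_left)
      then show False
        using frenet_frame_D(2)[OF fr' that] \<kappa>'[OF that] by (auto simp: lorentz_inner_simps)
    qed
    with fb assms(3,9) show ?thesis
      unfolding bertrand_direction_curve_def bertrand_curve_def frenet_curve_def by blast
  qed

  ultimately have "(bertrand_direction_curve I \<alpha> T N B \<kappa> \<tau> X \<beta> \<longleftrightarrow> (\<exists>\<theta>. C \<theta>)) \<and>
       (\<forall>\<theta>. C \<theta> \<longrightarrow> (\<forall>s\<in>I. lorentz_line_angle (T s) (X s) \<theta>))"
    using angle by blast
  then show ?thesis
    unfolding Let_def C_def A_def A'_def A''_def .
qed

end
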